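(* Let $D$ be a strongly connected and neighborhood-cyclic digraph with $n\geq 5$ vertices and $m$ arcs. Then $$m\geq \frac{7}{3}n,$$ and equality $m=\frac{7}{3}n$ holds if and only if $D\in {\cal D}$.
   Context: Digraphs are finite, without loops and without parallel arcs (two arcs of opposite orientation between the same pair of vertices are allowed; such a pair forms a directed cycle of length $2$). A digraph is cyclic if it contains a directed cycle (directed cycles of length $2$ count), and acyclic otherwise. A set $U$ of vertices of a digraph $D$ is cyclic (in $D$) if the subdigraph $D[U]$ of $D$ induced by $U$ is cyclic. For a vertex $u$ of $D$, $N^+_D(u)$ denotes the out-neighborhood of $u$ (the set of vertices $v$ such that $(u,v)$ is an arc of $D$) and $N^-_D(u)$ denotes the in-neighborhood of $u$ (the set of vertices $v$ such that $(v,u)$ is an arc of $D$). A digraph $D$ is neighborhood-cyclic if, for every vertex $u$ of $D$, both $N^+_D(u)$ and $N^-_D(u)$ are cyclic in $D$. The complete digraph $\overset{\leftrightarrow}{K}_3$ of order $3$ is the digraph with $3$ vertices and all $6$ possible arcs between distinct vertices. The set ${\cal D}$ is the set of digraphs $D$ that arise from $k\geq 2$ disjoint copies $D_0,\ldots,D_{k-1}$ of $\overset{\leftrightarrow}{K}_3$ by adding, for every $i\in\{0,1,\ldots,k-1\}$, one arc from some vertex in $D_i$ to some vertex in $D_{(i+1)\bmod k}$ (the choices of the end vertices are arbitrary for each $i$; membership in ${\cal D}$ is understood up to isomorphism). *)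

theory Defs
  imports "Graph_Theory.Graph_Theory" "HOL-Library.Disjoint_Sets"
begin

definition out_neighborhood :: "('a, 'b) pre_digraph \<Rightarrow> 'a \<Rightarrow> 'a set" where
  "out_neighborhood D u = {v. u \<rightarrow>\<^bsub>D\<^esub> v}"

definition in_neighborhood :: "('a, 'b) pre_digraph \<Rightarrow> 'a \<Rightarrow> 'a set" where
  "in_neighborhood D u = {v. v \<rightarrow>\<^bsub>D\<^esub> u}"

definition cyclic :: "('a, 'b) pre_digraph \<Rightarrow> bool" where
  "cyclic D \<longleftrightarrow> (\<exists>p. pre_digraph.cycle D p)"

definition cyclic_set :: "('a, 'b) pre_digraph \<Rightarrow> 'a set \<Rightarrow> bool" where
  "cyclic_set D U \<longleftrightarrow> cyclic (D \<restriction> U)"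

definition neighborhood_cyclic :: "('a, 'b) pre_digraph \<Rightarrow> bool" where
  "neighborhood_cyclic D \<longleftrightarrow>
    (\<forall>u \<in> verts D. cyclic_set D (out_neighborhood D u) \<and> cyclic_set D (in_neighborhood D u))"

text \<open>
  The members of \<open>family_D\<close> are built on natural numbers as vertices; since every finite digraph
  has an isomorphic copy of this kind, all isomorphism types occur. The vertices \<open>s i\<close> and \<open>t i\<close>
  are the tail and the head of the arc added from copy \<open>i\<close> to its cyclic successor.
\<close>

definition family_D :: "nat pair_pre_digraph set" where
  "family_D =
    {\<lparr>pverts = (\<Union>i<k. pverts (C i)),
      parcs = (\<Union>i<k. parcs (C i)) \<union> (\<lambda>i. (s i, t i)) ` {..<k}\<rparr> | (k :: nat) C s t.
        k \<ge> 2 \<and>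
        (\<forall>i<k. complete_digraph 3 (with_proj (C i))) \<and>
        disjoint_family_on (\<lambda>i. pverts (C i)) {..<k} \<and>
        (\<forall>i<k. s i \<in> pverts (C i) \<and> t i \<in> pverts (C ((i + 1) mod k)))}"

definition in_family_D :: "('a, 'b) pre_digraph \<Rightarrow> bool" where
  "in_family_D D \<longleftrightarrow> (\<exists>H \<in> family_D. digraph_iso (with_proj H) D)"

end

theory Submission
  imports Defs
begin

text \<open>
  Every out-degree is at least \<open>2\<close>. Let \<open>A\<close> be the set of vertices of out-degree \<open>2\<close>, each of which
  has two mutually adjacent out-neighbours, and let \<open>B\<close> be its complement. Each \<open>v \<in> A\<close> receives an
  arc from a vertex \<open>g v \<in> B\<close> that is an out-neighbour of \<open>v\<close> or has an out-neighbour in \<open>B\<close>. A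
  vertex \<open>b\<close> of out-degree \<open>3\<close> is not assigned to all of its out-neighbours, since together with
  them it would form a proper subset without leaving arcs. Hence
  \<open>7 + card {v \<in> A. g v = b} \<le> 3 * card (N b)\<close> for all \<open>b \<in> B\<close>, and summation gives the bound.

  In the case of equality, every \<open>b \<in> B\<close> has out-degree \<open>3\<close> and is assigned to exactly two vertices,
  whatever the choice of \<open>g\<close>. This forces every \<open>v \<in> A\<close> to have exactly one out-neighbour in \<open>B\<close>,
  and \<open>g v\<close> may be taken to be this vertex. Then \<open>b\<close> and the two vertices assigned to it span a
  complete digraph left by one single arc, which starts in \<open>b\<close>. By strong connectivity these arcs
  arrange the complete digraphs in a cycle.
\<close>

section \<open>Self-maps without proper invariant subsets\<close>

text \<open>By minimality every nonempty invariant subset is all of \<open>B\<close>. Applied to the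
  iterates of positive order this makes \<open>b0\<close> recur; applied to the iterates before the
  first return it shows that they exhaust \<open>B\<close>.\<close>

lemma orbit_enumeration:
  assumes "finite B" "b0 \<in> B" and maps: "h ` B \<subseteq> B"
    and min: "\<And>S. S \<subseteq> B \<Longrightarrow> S \<noteq> {} \<Longrightarrow> h ` S \<subseteq> S \<Longrightarrow> S = B"
  obtains k where "k > 0" "(h ^^ k) b0 = b0" "bij_betw (\<lambda>i. (h ^^ i) b0) {..<k} B"
proof -
  have inB: "(h ^^ i) b0 \<in> B" for i
    by (induction i) (use assms in auto)
  \<comment> \<open>The exponent \<open>0\<close> is excluded, so that \<open>b0\<close> belonging
    to this set is a genuine return.\<close>
  have "{(h ^^ i) b0 | i. i > 0} = B"
  proof (rule min)
    show "h ` {(h ^^ i) b0 | i. i > 0} \<subseteq> {(h ^^ i) b0 | i. i > 0}"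
    proof clarify
      fix i :: nat assume "i > 0"
      then show "\<exists>j. h ((h ^^ i) b0) = (h ^^ j) b0 \<and> j > 0"
        by (intro exI[of _ "Suc i"]) auto
    qed
  qed (use inB in auto)
  then obtain i where i: "i > 0" "(h ^^ i) b0 = b0"
    using \<open>b0 \<in> B\<close> by force
  define k where "k = (LEAST k. k > 0 \<and> (h ^^ k) b0 = b0)"
  have k: "k > 0" "(h ^^ k) b0 = b0"
    using LeastI[of "\<lambda>k. k > 0 \<and> (h ^^ k) b0 = b0" i] i unfolding k_def by auto
  have least: "(h ^^ j) b0 \<noteq> b0" if "0 < j" "j < k" for j
    using not_less_Least[of j "\<lambda>k. k > 0 \<and> (h ^^ k) b0 = b0"] that unfolding k_def by auto
  have "(\<lambda>i. (h ^^ i) b0) ` {..<k} = B"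
  proof (rule min)
    show "h ` (\<lambda>i. (h ^^ i) b0) ` {..<k} \<subseteq> (\<lambda>i. (h ^^ i) b0) ` {..<k}"
    proof clarify
      fix i assume "i < k"
      have "h ((h ^^ i) b0) = (h ^^ Suc i) b0" by simp
      \<comment> \<open>The last of the \<open>k\<close> iterates is sent back to exponent
        \<open>0\<close>.\<close>
      also have "\<dots> = (h ^^ (if Suc i = k then 0 else Suc i)) b0"
        using k(2) by (cases "Suc i = k") (simp_all del: funpow.simps add: funpow_0)
      finally show "h ((h ^^ i) b0) \<in> (\<lambda>i. (h ^^ i) b0) ` {..<k}"
        using \<open>i < k\<close> k by (intro image_eqI[of _ _ "if Suc i = k then 0 else Suc i"]) auto
    qed
  qed (use inB k in auto)
  moreover have "inj_on (\<lambda>i. (h ^^ i) b0) {..<k}"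
  proof (rule linorder_inj_onI)
    fix i j assume ij: "i < j" "i \<in> {..<k}" "j \<in> {..<k}"
    show "(h ^^ i) b0 \<noteq> (h ^^ j) b0"
    proof
      assume eq: "(h ^^ i) b0 = (h ^^ j) b0"
      \<comment> \<open>Applying \<open>h\<close> another \<open>k - j\<close> times turns a
        coincidence at \<open>i < j\<close> into a return to \<open>b0\<close> after fewer than
        \<open>k\<close> steps.\<close>
      have "(h ^^ (k - j + i)) b0 = (h ^^ (k - j + j)) b0"
        by (simp only: funpow_add o_apply eq)
      moreover have "0 < k - j + i" "k - j + i < k" using ij by auto
      ultimately show False
        using least[of "k - j + i"] ij k(2) by simp
    qed
  qed auto
  ultimately show thesis
    using that k by (auto simp: bij_betw_def)
qed

section \<open>Degree bound for out-neighbourhood functions\<close>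

text \<open>Only the following consequence of being cyclic is used: a cyclic set contains a nonempty
  subset each of whose vertices has an out-neighbour in the subset.\<close>

locale neighborhood_cyclic_relation =
  fixes V :: "'a set" and N :: "'a \<Rightarrow> 'a set"
  assumes fin: "finite V"
    and sub: "u \<in> V \<Longrightarrow> N u \<subseteq> V"
    and irrefl: "u \<notin> N u"
    and out_cyc: "u \<in> V \<Longrightarrow> \<exists>S. S \<noteq> {} \<and> S \<subseteq> N u \<and> (\<forall>x\<in>S. N x \<inter> S \<noteq> {})"
    and in_cyc: "u \<in> V \<Longrightarrow> \<exists>S. S \<noteq> {} \<and> S \<subseteq> V \<and> (\<forall>x\<in>S. u \<in> N x \<and> N x \<inter> S \<noteq> {})"
    and closed_eq: "S \<subseteq> V \<Longrightarrow> S \<noteq> {} \<Longrightarrow> (\<And>x. x \<in> S \<Longrightarrow> N x \<subseteq> S) \<Longrightarrow> S = V"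
    and card5: "card V \<ge> 5"
begin

definition "A = {u \<in> V. card (N u) = 2}"
definition "B = V - A"

lemma V_split: "V = A \<union> B" "A \<inter> B = {}" "finite A" "finite B"
  using fin by (auto simp: A_def B_def)

lemma finite_N: "u \<in> V \<Longrightarrow> finite (N u)"
  using sub fin finite_subset by blast

lemma card_N_ge: assumes "u \<in> V" shows "card (N u) \<ge> 2"
proof -
  obtain S where S: "S \<noteq> {}" "S \<subseteq> N u" "\<forall>x\<in>S. N x \<inter> S \<noteq> {}" using out_cyc[OF assms] by blast
  then obtain x y where "x \<in> S" "y \<in> S" "y \<in> N x" by blast
  then have "{x, y} \<subseteq> N u" "x \<noteq> y" using S irrefl by auto
  then show ?thesis using card_mono[of "N u" "{x, y}"] finite_N assms by auto
qed

lemma card_N_B: "b \<in> B \<Longrightarrow> card (N b) \<ge> 3"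
  using card_N_ge[of b] by (auto simp: A_def B_def)

text \<open>Without loops, a cyclic subset of a two-element set must be the whole set, with arcs in
  both directions.\<close>

lemma N_A:
  assumes "u \<in> A" "v \<in> N u"
  obtains w where "N u = {v, w}" "v \<noteq> w" "w \<in> N v" "v \<in> N w"
proof -
  have u: "u \<in> V" "card (N u) = 2" using assms by (auto simp: A_def)
  obtain a c where "N u = {a, c}" "a \<noteq> c" using u(2) by (auto simp: card_2_iff)
  then obtain w where w: "N u = {v, w}" "v \<noteq> w"
    using assms(2) by (cases "v = a") auto
  obtain S where S: "S \<noteq> {}" "S \<subseteq> N u" "\<forall>x\<in>S. N x \<inter> S \<noteq> {}" using out_cyc[OF u(1)] by blast
  have "v \<notin> N v" "w \<notin> N w" using irrefl by auto
  moreover have "S \<subseteq> {v, w}" using S(2) w(1) by simp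
  ultimately have "S = {v, w}" using S(1,3) by blast
  then have "N v \<inter> {v, w} \<noteq> {}" "N w \<inter> {v, w} \<noteq> {}" using S(3) by auto
  then have "w \<in> N v" "v \<in> N w" using \<open>v \<notin> N v\<close> \<open>w \<notin> N w\<close> by auto
  with w that show thesis by blast
qed

lemma N_A_pair:
  assumes "u \<in> A" "N u = {v, w}"
  shows "v \<noteq> w" "w \<in> N v" "v \<in> N w"
proof -
  have "v \<in> N u" using assms by simp
  then obtain w' where w': "N u = {v, w'}" "v \<noteq> w'" "w' \<in> N v" "v \<in> N w'"
    by (rule N_A[OF assms(1)])
  then have "w' = w" using assms(2) by (auto simp: doubleton_eq_iff)
  with w' show "v \<noteq> w" "w \<in> N v" "v \<in> N w" by auto
qed

text \<open>If the second out-neighbour \<open>w\<close> of \<open>u\<close> lies in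
  \<open>A\<close>, the mutual arcs force \<open>N v = {w, x}\<close> and
  \<open>N w = {v, x}\<close>, so \<open>w\<close> can replace \<open>u\<close> as soon as
  \<open>x\<close> is in \<open>B\<close>. Were \<open>x\<close> in \<open>A\<close>, then
  \<open>{v, w, x}\<close> would be closed, against \<open>card V \<ge> 5\<close>.\<close>

lemma A_out_neighbor_in_A:
  assumes "v \<in> A" "u \<in> A" "v \<in> N u"
  obtains u' b where "u' \<in> A" "b \<in> B" "N u' = {v, b}"
proof -
  obtain w where w: "N u = {v, w}" "v \<noteq> w" "w \<in> N v" "v \<in> N w" by (rule N_A[OF assms(2,3)])
  have "w \<in> V" using w sub assms by (auto simp: A_def)
  show thesis
  proof (cases "w \<in> B")
    case True then show ?thesis using that assms w by blast
  next
    case False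
    then have "w \<in> A" using \<open>w \<in> V\<close> by (auto simp: B_def)
    obtain x where x: "N v = {w, x}" "w \<noteq> x" "x \<in> N w" "w \<in> N x"
      by (rule N_A[OF assms(1) w(3)])
    have "v \<noteq> x" using x irrefl by blast
    obtain y where y: "N w = {v, y}" by (rule N_A[OF \<open>w \<in> A\<close> w(4)])
    then have Nw: "N w = {v, x}" using x \<open>v \<noteq> x\<close> by auto
    then have vx: "v \<in> N x" using N_A_pair \<open>w \<in> A\<close> by blast
    have "x \<in> B"
    proof (rule ccontr)
      assume "x \<notin> B"
      moreover have "x \<in> V" using x sub assms by (auto simp: A_def)
      ultimately have "x \<in> A" by (auto simp: B_def)
      obtain z where "N x = {v, z}" by (rule N_A[OF \<open>x \<in> A\<close> vx])
      then have Nx: "N x = {v, w}" using x w by auto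
      have "{v, w, x} = V"
        by (rule closed_eq) (use x Nw Nx \<open>x \<in> V\<close> \<open>w \<in> V\<close> assms in \<open>auto simp: A_def\<close>)
      moreover have "card {v, w, x} \<le> 3" by (simp add: card_insert_if)
      ultimately show False using card5 by simp
    qed
    then show ?thesis using that[of w x] \<open>w \<in> A\<close> Nw by blast
  qed
qed

text \<open>The disjunction is tailored to \<open>fibre_psubset\<close>: when all out-neighbours of
  \<open>b\<close> lie in \<open>A\<close>, only the first alternative remains.\<close>

definition sponsor :: "'a \<Rightarrow> 'a \<Rightarrow> bool" where
  "sponsor b v \<longleftrightarrow> b \<in> B \<and> v \<in> N b \<and> (b \<in> N v \<or> N b \<inter> B \<noteq> {})"

text \<open>A cyclic set of in-neighbours of \<open>v\<close> lies in \<open>B\<close>, and one can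
  walk two steps inside it. The first step makes \<open>b\<close> a sponsor of \<open>v\<close>; the
  second is used in the case of equality.\<close>

lemma no_A_in_neighbor:
  assumes "v \<in> A" "\<And>u. u \<in> A \<Longrightarrow> v \<notin> N u"
  obtains b b' b'' where "{b, b', b''} \<subseteq> B" "v \<in> N b" "v \<in> N b'" "b' \<in> N b" "b'' \<in> N b'"
proof -
  obtain S where S: "S \<noteq> {}" "S \<subseteq> V" "\<forall>x\<in>S. v \<in> N x \<and> N x \<inter> S \<noteq> {}"
    using in_cyc[of v] assms(1) unfolding A_def by blast
  then have "S \<subseteq> B" using assms(2) unfolding B_def by blast
  obtain b where "b \<in> S" using S by blast
  moreover obtain b' where "b' \<in> S" "b' \<in> N b" using S \<open>b \<in> S\<close> by blast
  moreover obtain b'' where "b'' \<in> S" "b'' \<in> N b'" using S \<open>b' \<in> S\<close> by blast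
  ultimately show thesis using S \<open>S \<subseteq> B\<close> that[of b b' b''] by blast
qed

lemma sponsor_exists:
  assumes "v \<in> A" shows "\<exists>b. sponsor b v"
proof (cases "\<exists>u\<in>A. v \<in> N u")
  case True
  then obtain u b where "u \<in> A" "b \<in> B" "N u = {v, b}" by (auto elim: A_out_neighbor_in_A[OF assms])
  then have "sponsor b v" using N_A_pair[of u v b] by (auto simp: sponsor_def)
  then show ?thesis ..
next
  case False
  then have "\<And>u. u \<in> A \<Longrightarrow> v \<notin> N u" by blast
  then obtain b b' b'' where "{b, b', b''} \<subseteq> B" "v \<in> N b" "b' \<in> N b"
    by (rule no_A_in_neighbor[OF assms])
  then have "sponsor b v" by (auto simp: sponsor_def)
  then show ?thesis ..
qed

definition fibre :: "('a \<Rightarrow> 'a) \<Rightarrow> 'a \<Rightarrow> 'a set" where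
  "fibre g b = {v \<in> A. g v = b}"

text \<open>If \<open>b\<close> were assigned to all of \<open>N b\<close>, each \<open>x\<close> in
  \<open>N b\<close> would have \<open>b\<close> as an out-neighbour, and by \<open>N_A\<close> its
  other out-neighbour would be in \<open>N b\<close>. Then \<open>insert b (N b)\<close> would be
  closed with at most four vertices.\<close>

lemma fibre_psubset:
  assumes g: "\<And>v. v \<in> A \<Longrightarrow> sponsor (g v) v" and "b \<in> B" and d: "card (N b) \<le> 3"
  shows "fibre g b \<subset> N b"
proof -
  have "fibre g b \<subseteq> N b" using g by (auto simp: fibre_def sponsor_def)
  moreover have "fibre g b \<noteq> N b"
  proof
    assume eq: "fibre g b = N b"
    have bV: "b \<in> V" using \<open>b \<in> B\<close> by (auto simp: B_def)
    have NA: "N b \<subseteq> A" using eq by (auto simp: fibre_def)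
    have "insert b (N b) = V"
    proof (rule closed_eq)
      fix x assume "x \<in> insert b (N b)"
      then show "N x \<subseteq> insert b (N b)"
      proof
        assume x: "x \<in> N b"
        then have "x \<in> A" "g x = b" using eq by (auto simp: fibre_def)
        then have "sponsor b x" using g by blast
        then have "b \<in> N x" using NA V_split by (auto simp: sponsor_def)
        then obtain y where "N x = {b, y}" "y \<in> N b" by (rule N_A[OF \<open>x \<in> A\<close>])
        then show ?thesis by blast
      qed auto
    qed (use bV sub in auto)
    moreover have "card (insert b (N b)) \<le> 4"
      using d finite_N[OF bV] by (simp add: card_insert_if)
    ultimately show False using card5 by simp
  qed
  ultimately show ?thesis by blast
qed

text \<open>For out-degree \<open>d \<ge> 4\<close> the trivial bound \<open>d\<close> on the fibre
  gives a strict inequality, as \<open>7 + d < 3 * d\<close>. For \<open>d = 3\<close> the fibre has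
  at most two elements, and equality needs exactly two.\<close>

lemma fibre_bound:
  assumes g: "\<And>v. v \<in> A \<Longrightarrow> sponsor (g v) v" and b: "b \<in> B"
  shows "7 + card (fibre g b) \<le> 3 * card (N b)"
    and "7 + card (fibre g b) = 3 * card (N b) \<Longrightarrow> card (N b) = 3 \<and> card (fibre g b) = 2"
proof -
  have f: "finite (N b)" using b finite_N by (auto simp: B_def)
  have "fibre g b \<subseteq> N b" using g by (auto simp: fibre_def sponsor_def)
  then have le: "card (fibre g b) \<le> card (N b)" using f card_mono by blast
  have lt: "card (fibre g b) < 3" if "card (N b) = 3"
    using psubset_card_mono[OF f fibre_psubset[OF g b]] that by auto
  show "7 + card (fibre g b) \<le> 3 * card (N b)"
    and "7 + card (fibre g b) = 3 * card (N b) \<Longrightarrow> card (N b) = 3 \<and> card (fibre g b) = 2"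
    using le lt card_N_B[OF b] by linarith+
qed

text \<open>A vertex of \<open>A\<close> contributes \<open>6\<close> to three times the degree sum,
  one short of \<open>7\<close>. The fibres partition \<open>A\<close>, so their sizes supply
  exactly the missing units.\<close>

lemma degree_sum:
  assumes g: "\<And>v. v \<in> A \<Longrightarrow> sponsor (g v) v"
  shows "3 * (\<Sum>u\<in>V. card (N u)) + (\<Sum>b\<in>B. 7 + card (fibre g b)) =
    7 * card V + (\<Sum>b\<in>B. 3 * card (N b))"
proof -
  have "(\<Sum>b\<in>B. card (fibre g b)) = card A"
    using sum.group[of A B g "\<lambda>_. 1::nat"] g V_split
    by (auto simp: fibre_def sponsor_def)
  moreover have "(\<Sum>u\<in>A. card (N u)) = 2 * card A" by (simp add: A_def)
  moreover have "card V = card A + card B"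
    using card_Un_disjoint[of A B] V_split by simp
  moreover have "(\<Sum>u\<in>V. card (N u)) = (\<Sum>u\<in>A. card (N u)) + (\<Sum>u\<in>B. card (N u))"
    using sum.union_disjoint[of A B] V_split by simp
  ultimately show ?thesis by (simp add: sum.distrib flip: sum_distrib_left)
qed

theorem degree_sum_ge: "7 * card V \<le> 3 * (\<Sum>u\<in>V. card (N u))"
proof -
  obtain g where g: "\<And>v. v \<in> A \<Longrightarrow> sponsor (g v) v" using sponsor_exists by metis
  have "(\<Sum>b\<in>B. 7 + card (fibre g b)) \<le> (\<Sum>b\<in>B. 3 * card (N b))"
    by (rule sum_mono) (rule fibre_bound(1)[OF g])
  then show ?thesis using degree_sum[OF g] by linarith
qed

end

section \<open>The case of equality: blocks arranged in a cycle\<close>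

locale extremal_relation = neighborhood_cyclic_relation +
  assumes tight: "3 * (\<Sum>u\<in>V. card (N u)) = 7 * card V"
begin

text \<open>Termwise inequalities with equal sums are equalities. The conclusion holds for every
  choice of sponsors, so \<open>g\<close> may be adapted to the situation.\<close>

lemma fibre_tight:
  assumes g: "\<And>v. v \<in> A \<Longrightarrow> sponsor (g v) v" and b: "b \<in> B"
  shows "card (N b) = 3" "card (fibre g b) = 2"
proof -
  have eq: "(\<Sum>b\<in>B. 7 + card (fibre g b)) = (\<Sum>b\<in>B. 3 * card (N b))"
    using degree_sum[OF g] tight by linarith
  have "7 + card (fibre g b) = 3 * card (N b)"
    by (rule sum_mono_inv[OF eq fibre_bound(1)[OF g] b V_split(4)])
  then show "card (N b) = 3" "card (fibre g b) = 2" using fibre_bound(2)[OF g b] by auto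
qed

text \<open>Otherwise the sponsor of \<open>v\<close> could be chosen such that some other vertex of \<open>B\<close> has two
  out-neighbours that it does not sponsor.\<close>

lemma in_neighbor_in_A:
  assumes "v \<in> A" shows "\<exists>u\<in>A. v \<in> N u"
proof (rule ccontr)
  assume "\<not> ?thesis"
  then have "\<And>u. u \<in> A \<Longrightarrow> v \<notin> N u" by blast
  then obtain b b' b'' where b: "{b, b', b''} \<subseteq> B" "v \<in> N b" "v \<in> N b'" "b' \<in> N b" "b'' \<in> N b'"
    by (rule no_A_in_neighbor[OF assms])
  obtain g0 where g0: "\<And>v. v \<in> A \<Longrightarrow> sponsor (g0 v) v" using sponsor_exists by metis
  define g where "g = g0(v := b)"
  have g: "sponsor (g x) x" if "x \<in> A" for x
    using g0 that b by (auto simp: g_def sponsor_def)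
  have b': "b' \<in> B" "b' \<in> V" using b by (auto simp: B_def)
  have f: "finite (N b')" using finite_N b' by blast
  have "b' \<noteq> b" using b irrefl by blast
  have "b'' \<noteq> v" "b'' \<notin> A" using b assms V_split by auto
  \<comment> \<open>The vertex \<open>v\<close> is now assigned to \<open>b\<close>, and
    \<open>b''\<close> is not in \<open>A\<close>. At most one of the three out-neighbours of
    \<open>b'\<close> is left for its fibre.\<close>
  have "fibre g b' \<subseteq> N b' - {v, b''}"
  proof
    fix x assume "x \<in> fibre g b'"
    then have "x \<in> A" "g x = b'" by (auto simp: fibre_def)
    moreover have "x \<in> N b'" using g[OF \<open>x \<in> A\<close>] \<open>g x = b'\<close> by (simp add: sponsor_def)
    ultimately show "x \<in> N b' - {v, b''}" using \<open>b' \<noteq> b\<close> \<open>b'' \<notin> A\<close> by (auto simp: g_def)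
  qed
  then have "card (fibre g b') \<le> card (N b' - {v, b''})" using f card_mono by blast
  also have "\<dots> = card (N b') - 2"
    using b \<open>b'' \<noteq> v\<close> by (subst card_Diff_subset) auto
  finally show False using fibre_tight[OF g \<open>b' \<in> B\<close>] by simp
qed

text \<open>Mapping each suitable \<open>u\<close> to its out-neighbour in \<open>A\<close> is onto \<open>A\<close>, hence defined on all of \<open>A\<close>.\<close>

lemma N_A_mixed:
  assumes "u \<in> A"
  obtains v b where "v \<in> A" "b \<in> B" "N u = {v, b}"
proof -
  define A2 where "A2 = {u \<in> A. \<exists>v\<in>A. \<exists>b\<in>B. N u = {v, b}}"
  define f where "f u = (THE v. v \<in> A \<and> v \<in> N u)" for u
  have f: "f u = v" if "v \<in> A" "b \<in> B" "N u = {v, b}" for u v b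
    unfolding f_def by (rule the_equality) (use that V_split in auto)
  have "A \<subseteq> f ` A2"
  proof
    fix v assume v: "v \<in> A"
    then obtain u where "u \<in> A" "v \<in> N u" using in_neighbor_in_A by blast
    then obtain u' b where u': "u' \<in> A" "b \<in> B" "N u' = {v, b}" by (rule A_out_neighbor_in_A[OF v])
    then have "f u' = v" "u' \<in> A2" using f v by (auto simp: A2_def)
    then show "v \<in> f ` A2" by blast
  qed
  moreover have "finite A2" using V_split by (auto simp: A2_def)
  ultimately have "card A \<le> card A2" by (rule surj_card_le[rotated])
  moreover have "A2 \<subseteq> A" by (auto simp: A2_def)
  ultimately have "A2 = A" using card_seteq V_split by blast
  then show thesis using assms that by (auto simp: A2_def)
qed

text \<open>On \<open>A\<close> the description is well defined by \<open>N_A_mixed\<close>. Fixing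
  \<open>B\<close> pointwise makes each block contain its own center.\<close>

definition center :: "'a \<Rightarrow> 'a" where
  "center u = (if u \<in> A then THE b. b \<in> B \<and> b \<in> N u else u)"

lemma center_eq:
  assumes "u \<in> A" "v \<in> A" "b \<in> B" "N u = {v, b}" shows "center u = b"
  unfolding center_def using assms V_split by (auto intro!: the_equality)

lemma center_B: "b \<in> B \<Longrightarrow> center b = b"
  using V_split by (auto simp: center_def)

text \<open>Some \<open>u\<close> in \<open>A\<close> has \<open>N u = {v, b}\<close> with
  \<open>b\<close> in \<open>B\<close>, so \<open>v\<close> and \<open>b\<close> are mutually
  adjacent. As \<open>v\<close> has only one out-neighbour in \<open>B\<close>, this
  \<open>b\<close> is its center.\<close>

lemma center_mutual:
  assumes "v \<in> A" shows "center v \<in> B" "center v \<in> N v" "v \<in> N (center v)"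
proof -
  obtain u where "u \<in> A" "v \<in> N u" using in_neighbor_in_A assms by blast
  then obtain u b where u: "u \<in> A" "b \<in> B" "N u = {v, b}" by (rule A_out_neighbor_in_A[OF assms])
  then have vb: "b \<in> N v" "v \<in> N b" using N_A_pair by auto
  obtain x c where "x \<in> A" "c \<in> B" "N v = {x, c}" by (rule N_A_mixed[OF assms])
  then have "center v = b" using center_eq[OF assms] vb u V_split by auto
  with u vb show "center v \<in> B" "center v \<in> N v" "v \<in> N (center v)" by auto
qed

text \<open>The two out-neighbours of \<open>u\<close> are mutually adjacent, so the one in
  \<open>A\<close> has the other one, \<open>center u\<close>, as its unique out-neighbour in
  \<open>B\<close>.\<close>

lemma center_out_neighbor:
  assumes "u \<in> A" "v \<in> N u" shows "center v = center u"
proof -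
  obtain x b where x: "x \<in> A" "b \<in> B" "N u = {x, b}" by (rule N_A_mixed[OF assms(1)])
  then have b: "center u = b" using center_eq assms by blast
  have "b \<in> N x" using N_A_pair x assms by blast
  moreover obtain y c where y: "y \<in> A" "c \<in> B" "N x = {y, c}" by (rule N_A_mixed[OF x(1)])
  ultimately have "center x = b" using center_eq[of x y c] x V_split by auto
  then show ?thesis using assms x b center_B by auto
qed

definition block :: "'a \<Rightarrow> 'a set" where
  "block b = {u \<in> V. center u = b}"

lemma block_eq: "b \<in> B \<Longrightarrow> block b = insert b (fibre center b)"
  using center_B V_split by (fastforce simp: block_def fibre_def)

text \<open>Hence \<open>center\<close> is an admissible choice of \<open>g\<close> in
  \<open>fibre_tight\<close>.\<close>

lemma sponsor_center: "v \<in> A \<Longrightarrow> sponsor (center v) v"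
  using center_mutual by (auto simp: sponsor_def)

lemma card_block: assumes "b \<in> B" shows "card (block b) = 3"
proof -
  have "finite (fibre center b)" "b \<notin> fibre center b"
    using V_split assms by (auto simp: fibre_def)
  then show ?thesis using fibre_tight(2)[OF sponsor_center assms] block_eq[OF assms] by simp
qed

text \<open>The inclusion comes from \<open>center_out_neighbor\<close>; equality follows because
  both sides have two elements.\<close>

lemma N_in_block:
  assumes "u \<in> A" shows "N u = block (center u) - {u}"
proof (rule card_seteq)
  have b: "center u \<in> B" using center_mutual assms by blast
  have u: "u \<in> V" using assms by (auto simp: A_def)
  show "finite (block (center u) - {u})" using fin by (auto simp: block_def)
  show "N u \<subseteq> block (center u) - {u}"
    using center_out_neighbor assms irrefl sub[OF u] by (auto simp: block_def)
  have "card (block (center u) - {u}) = 2"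
    using card_block[OF b] u by (subst card_Diff_singleton) (auto simp: block_def)
  then show "card (block (center u) - {u}) \<le> card (N u)" using assms by (simp add: A_def)
qed

text \<open>Two of the three arcs leaving \<open>b\<close> go to its fibre. The third ends neither
  there nor, without loops, in \<open>b\<close>, so it leaves the block.\<close>

lemma N_center:
  assumes "b \<in> B" obtains t where "t \<in> V" "center t \<noteq> b" "N b = insert t (block b - {b})"
proof -
  have sub': "fibre center b \<subseteq> N b" using center_mutual by (auto simp: fibre_def)
  have bV: "b \<in> V" using assms by (auto simp: B_def)
  have "card (N b - fibre center b) = 1"
    using fibre_tight[OF sponsor_center assms] sub' V_split
    by (subst card_Diff_subset) (auto simp: fibre_def)
  then obtain t where t: "N b - fibre center b = {t}" by (auto simp: card_1_singleton_iff)
  then have "t \<in> N b" "t \<notin> fibre center b" by auto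
  then have tV: "t \<in> V" and "t \<notin> block b"
    using sub[OF bV] irrefl[of b] block_eq[OF assms] by auto
  then have "center t \<noteq> b" by (auto simp: block_def)
  moreover have "N b = insert t (fibre center b)" using t sub' by auto
  moreover have "fibre center b = block b - {b}"
    using block_eq[OF assms] assms V_split by (auto simp: fibre_def)
  ultimately show thesis using that tV by metis
qed

text \<open>Each block is left by one arc only, which defines a successor map \<open>h\<close> on
  the centers. Strong connectivity, in the form of \<open>closed_eq\<close>, makes \<open>h\<close>
  a single cycle through \<open>B\<close>.\<close>

theorem cyclic_block_structure:
  obtains k :: nat and X s t where "k \<ge> 2" "V = (\<Union>i<k. X i)" "disjoint_family_on X {..<k}"
    "\<And>i. i < k \<Longrightarrow> card (X i) = 3 \<and> s i \<in> X i \<and> t i \<in> X ((i + 1) mod k)"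
    "\<And>i x. i < k \<Longrightarrow> x \<in> X i \<Longrightarrow> N x = X i - {x} \<union> (if x = s i then {t i} else {})"
proof -
  obtain t where t: "\<And>b. b \<in> B \<Longrightarrow> t b \<in> V \<and> center (t b) \<noteq> b \<and> N b = insert (t b) (block b - {b})"
  proof -
    have "\<exists>t. t \<in> V \<and> center t \<noteq> b \<and> N b = insert t (block b - {b})" if "b \<in> B" for b
      using N_center[OF that] by blast
    then show thesis using that by metis
  qed
  define h where "h b = center (t b)" for b
  have cB: "center u \<in> B" if "u \<in> V" for u
    using that center_mutual center_B by (cases "u \<in> A") (auto simp: B_def)
  have maps: "h ` B \<subseteq> B" using t cB by (auto simp: h_def)
  have "V \<noteq> {}" using card5 by auto
  then obtain b0 where b0: "b0 \<in> B" using cB by blast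
  have "S = B" if S: "S \<subseteq> B" "S \<noteq> {}" "h ` S \<subseteq> S" for S
  proof -
    \<comment> \<open>The union of the blocks with centers in an \<open>h\<close>-invariant set has
      no leaving arcs.\<close>
    have "{u \<in> V. center u \<in> S} = V"
    proof (rule closed_eq)
      obtain b where "b \<in> S" using S by blast
      then have "b \<in> V" "center b = b" using S center_B by (auto simp: B_def)
      then show "{u \<in> V. center u \<in> S} \<noteq> {}" using \<open>b \<in> S\<close> by auto
    next
      fix x assume x: "x \<in> {u \<in> V. center u \<in> S}"
      show "N x \<subseteq> {u \<in> V. center u \<in> S}"
      proof (cases "x \<in> A")
        case True
        then show ?thesis using x N_in_block by (auto simp: block_def)
      next
        case False
        then have "x \<in> B" "x \<in> S" using x center_B by (auto simp: B_def)
        then show ?thesis using t[of x] S by (auto simp: block_def h_def)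
      qed
    qed auto
    then have "B \<subseteq> {u \<in> V. center u \<in> S}" by (auto simp: B_def)
    then show "S = B" using S center_B by auto
  qed
  then obtain k where k: "k > 0" "(h ^^ k) b0 = b0" and bij: "bij_betw (\<lambda>i. (h ^^ i) b0) {..<k} B"
    using orbit_enumeration[OF V_split(4) b0 maps] by blast
  define s where "s i = (h ^^ i) b0" for i
  have sB: "s i \<in> B" if "i < k" for i using bij that by (auto simp: s_def bij_betw_def)
  have smod: "s ((i + 1) mod k) = h (s i)" if "i < k" for i
  proof (cases "i + 1 = k")
    case True
    then have "h (s i) = (h ^^ k) b0" by (auto simp: s_def)
    then show ?thesis using True k by (simp add: s_def)
  next
    case False
    then show ?thesis using that by (simp add: s_def)
  qed
  show thesis
  proof (rule that[of k "\<lambda>i. block (s i)" s "\<lambda>i. t (s i)"])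
    \<comment> \<open>The arc leaving a block ends in a different block, which rules out a cycle of
      length one.\<close>
    have "h b0 \<noteq> b0" using t b0 by (auto simp: h_def)
    then have "k \<noteq> 1" using k by auto
    then show "k \<ge> 2" using k by auto
    have "s ` {..<k} = B" using bij by (simp add: s_def bij_betw_def)
    then have "\<exists>i<k. center u = s i" if "u \<in> V" for u using cB[OF that] by auto
    then show "V = (\<Union>i<k. block (s i))" by (auto simp: block_def)
    have "inj_on s {..<k}" using bij by (simp add: s_def[abs_def] bij_betw_def)
    then show "disjoint_family_on (\<lambda>i. block (s i)) {..<k}"
      by (auto simp: disjoint_family_on_def block_def inj_on_def)
  next
    fix i assume i: "i < k"
    show "card (block (s i)) = 3 \<and> s i \<in> block (s i) \<and> t (s i) \<in> block (s ((i + 1) mod k))"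
      using card_block[OF sB[OF i]] block_eq[OF sB[OF i]] t[OF sB[OF i]] smod[OF i]
      by (auto simp: block_def h_def)
    fix x assume x: "x \<in> block (s i)"
    show "N x = block (s i) - {x} \<union> (if x = s i then {t (s i)} else {})"
    proof (cases "x = s i")
      case True
      then show ?thesis using t[OF sB[OF i]] by auto
    next
      case False
      then have "x \<in> A" "center x = s i"
        using x block_eq[OF sB[OF i]] by (auto simp: fibre_def)
      then show ?thesis using N_in_block False by auto
    qed
  qed
qed

end

section \<open>From digraphs to out-neighbourhood functions\<close>

lemma cas_heads:
  "pre_digraph.cas G u p v \<Longrightarrow> head G ` set p \<subseteq> insert v (tail G ` set p)"
proof (induction p arbitrary: u)
  case (Cons e p)
  then have "pre_digraph.cas G (head G e) p v" by (simp add: pre_digraph.cas.simps)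
  then show ?case
    using Cons.IH[of "head G e"] by (cases p) (auto simp: pre_digraph.cas.simps)
qed simp

text \<open>The tails of the arcs of a directed cycle form \<open>S\<close>. Each head is the tail
  of the next arc, or the end vertex, which is the tail of the first arc.\<close>

lemma cyclic_setE:
  assumes "cyclic_set D U"
  obtains S where "S \<noteq> {}" "S \<subseteq> U" "\<forall>x\<in>S. \<exists>y\<in>S. x \<rightarrow>\<^bsub>D\<^esub> y"
proof -
  obtain p u where p: "p \<noteq> []" "set p \<subseteq> arcs (D \<restriction> U)" "pre_digraph.cas (D \<restriction> U) u p u"
    using assms unfolding cyclic_set_def cyclic_def pre_digraph.cycle_def pre_digraph.awalk_def
    by blast
  have "u \<in> tail D ` set p"
    using p by (cases p) (auto simp: pre_digraph.cas.simps)
  then have heads: "head D ` set p \<subseteq> tail D ` set p"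
    using cas_heads[OF p(3)] by auto
  show thesis
  proof (rule that)
    show "tail D ` set p \<noteq> {}" using p by simp
    show "tail D ` set p \<subseteq> U" using p by auto
    show "\<forall>x\<in>tail D ` set p. \<exists>y\<in>tail D ` set p. x \<rightarrow>\<^bsub>D\<^esub> y"
    proof
      fix x assume "x \<in> tail D ` set p"
      then obtain e where e: "e \<in> set p" "x = tail D e" by blast
      then have "x \<rightarrow>\<^bsub>D\<^esub> head D e" using p by (auto simp: arcs_ends_conv)
      moreover have "head D e \<in> tail D ` set p" using heads e by blast
      ultimately show "\<exists>y\<in>tail D ` set p. x \<rightarrow>\<^bsub>D\<^esub> y" by blast
    qed
  qed
qed

lemma strongly_connected_closed_eq:
  assumes "strongly_connected D" "S \<subseteq> verts D" "S \<noteq> {}"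
    and closed: "\<And>x. x \<in> S \<Longrightarrow> out_neighborhood D x \<subseteq> S"
  shows "S = verts D"
proof
  obtain u where u: "u \<in> S" using assms by blast
  show "verts D \<subseteq> S"
  proof
    fix v assume "v \<in> verts D"
    then have "u \<rightarrow>\<^sup>*\<^bsub>D\<^esub> v" using assms u by (auto simp: strongly_connected_def)
    then have "(u, v) \<in> (arcs_ends D)\<^sup>*" by (rule reachable_rtranclI)
    then show "v \<in> S"
      by induction (use u closed in \<open>auto simp: out_neighborhood_def\<close>)
  qed
qed (rule assms)

lemma neighborhood_cyclic_relation_digraph:
  assumes "digraph D" "strongly_connected D" "neighborhood_cyclic D" "card (verts D) \<ge> 5"
  shows "neighborhood_cyclic_relation (verts D) (out_neighborhood D)"
proof -
  interpret digraph D by fact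
  show ?thesis
  proof
    fix u assume u: "u \<in> verts D"
    show "out_neighborhood D u \<subseteq> verts D"
      by (auto simp: out_neighborhood_def dest: adj_in_verts)
    have "cyclic_set D (out_neighborhood D u)"
      using assms(3) u by (simp add: neighborhood_cyclic_def)
    then obtain S where S: "S \<noteq> {}" "S \<subseteq> out_neighborhood D u"
      "\<forall>x\<in>S. \<exists>y\<in>S. x \<rightarrow>\<^bsub>D\<^esub> y"
      by (rule cyclic_setE)
    have "out_neighborhood D x \<inter> S \<noteq> {}" if "x \<in> S" for x
      using S(3) that by (auto simp: out_neighborhood_def)
    with S(1,2) show "\<exists>S. S \<noteq> {} \<and> S \<subseteq> out_neighborhood D u \<and> (\<forall>x\<in>S. out_neighborhood D x \<inter> S \<noteq> {})"
      by (intro exI[of _ S] conjI ballI)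
    have "cyclic_set D (in_neighborhood D u)"
      using assms(3) u by (simp add: neighborhood_cyclic_def)
    then obtain S where S: "S \<noteq> {}" "S \<subseteq> in_neighborhood D u"
      "\<forall>x\<in>S. \<exists>y\<in>S. x \<rightarrow>\<^bsub>D\<^esub> y"
      by (rule cyclic_setE)
    have "out_neighborhood D x \<inter> S \<noteq> {}" if "x \<in> S" for x
      using S(3) that by (auto simp: out_neighborhood_def)
    moreover have "u \<in> out_neighborhood D x" "x \<in> verts D" if "x \<in> S" for x
      using S(2) that by (auto simp: in_neighborhood_def out_neighborhood_def dest: adj_in_verts)
    ultimately show "\<exists>S. S \<noteq> {} \<and> S \<subseteq> verts D \<and>
        (\<forall>x\<in>S. u \<in> out_neighborhood D x \<and> out_neighborhood D x \<inter> S \<noteq> {})"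
      using S(1) by (intro exI[of _ S] conjI ballI subsetI)
  next
    fix u show "u \<notin> out_neighborhood D u"
      by (auto simp: out_neighborhood_def dest: adj_not_same)
  next
    fix S assume "S \<subseteq> verts D" "S \<noteq> {}" "\<And>x. x \<in> S \<Longrightarrow> out_neighborhood D x \<subseteq> S"
    then show "S = verts D" by (rule strongly_connected_closed_eq[OF assms(2)])
  qed (use assms(4) in simp_all)
qed

lemma arcs_ends_eq_Sigma:
  assumes "wf_digraph D" shows "arcs_ends D = (SIGMA u:verts D. out_neighborhood D u)"
proof -
  interpret wf_digraph D by fact
  show ?thesis by (auto simp: out_neighborhood_def dest: adj_in_verts)
qed

text \<open>Without parallel arcs, arcs correspond to pairs of end vertices, which are counted by
  their tails.\<close>

lemma card_arcs_eq_sum: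
  assumes "digraph D"
  shows "card (arcs D) = (\<Sum>u\<in>verts D. card (out_neighborhood D u))"
proof -
  interpret digraph D by fact
  have "card (arcs D) = card (arcs_ends D)"
    using card_image[OF inj_on_arc_to_ends] by (simp add: arcs_ends_def)
  also have "\<dots> = card (SIGMA u:verts D. out_neighborhood D u)"
    using arcs_ends_eq_Sigma[of D] wf_digraph by simp
  also have "\<dots> = (\<Sum>u\<in>verts D. card (out_neighborhood D u))"
  proof (rule card_SigmaI)
    have "out_neighborhood D u \<subseteq> verts D" for u
      by (auto simp: out_neighborhood_def dest: adj_in_verts)
    then show "\<forall>u\<in>verts D. finite (out_neighborhood D u)"
      using finite_verts finite_subset by blast
  qed simp
  finally show ?thesis .
qed

section \<open>Counting vertices and arcs in the family\<close>

lemma card_complete_digraph_3: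
  assumes "complete_digraph 3 (with_proj G)"
  shows "finite (pverts G)" "card (pverts G) = 3" "finite (parcs G)" "card (parcs G) = 6"
    "parcs G \<subseteq> pverts G \<times> pverts G"
proof -
  have G: "finite (pverts G)" "card (pverts G) = 3"
    "parcs G = {(u, v). (u, v) \<in> pverts G \<times> pverts G \<and> u \<noteq> v}"
    using assms by (simp_all add: complete_digraph_pair_def)
  then have eq: "parcs G = (SIGMA u:pverts G. pverts G - {u})" by auto
  have "card (parcs G) = (\<Sum>u\<in>pverts G. card (pverts G - {u}))"
    unfolding eq by (rule card_SigmaI) (use G in auto)
  also have "\<dots> = (\<Sum>u\<in>pverts G. 2)" using G by (intro sum.cong) auto
  finally show "card (parcs G) = 6" using G by simp
  show "finite (pverts G)" "card (pverts G) = 3" "finite (parcs G)"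
    "parcs G \<subseteq> pverts G \<times> pverts G"
    using G(1,2) by (auto simp: eq)
qed

text \<open>The copies contribute \<open>3 * k\<close> vertices and \<open>6 * k\<close> arcs, and
  the connecting arcs are \<open>k\<close> further ones. They are distinct because their tails lie
  in disjoint copies.\<close>

lemma card_family_D:
  assumes "H \<in> family_D" shows "3 * card (parcs H) = 7 * card (pverts H)"
proof -
  obtain k :: nat and C s t where k: "k \<ge> 2"
    and C: "\<And>i. i < k \<Longrightarrow> complete_digraph 3 (with_proj (C i))"
    and disj: "disjoint_family_on (\<lambda>i. pverts (C i)) {..<k}"
    and st: "\<And>i. i < k \<Longrightarrow> s i \<in> pverts (C i) \<and> t i \<in> pverts (C ((i + 1) mod k))"
    and H: "H = \<lparr>pverts = (\<Union>i<k. pverts (C i)),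
      parcs = (\<Union>i<k. parcs (C i)) \<union> (\<lambda>i. (s i, t i)) ` {..<k}\<rparr>"
    using assms unfolding family_D_def by blast
  note C3 = card_complete_digraph_3[OF C]
  have D: "pverts (C i) \<inter> pverts (C j) = {}" if "i < k" "j < k" "i \<noteq> j" for i j
    using disj that by (auto simp: disjoint_family_on_def)
  have "card (\<Union>i<k. pverts (C i)) = (\<Sum>i<k. card (pverts (C i)))"
    by (rule card_UN_disjoint) (use C3 D in auto)
  also have "\<dots> = 3 * k" using C3 by simp
  finally have v: "card (pverts H) = 3 * k" by (simp add: H)
  have "parcs (C i) \<inter> parcs (C j) = {}" if "i < k" "j < k" "i \<noteq> j" for i j
    using C3(5)[OF that(1)] C3(5)[OF that(2)] D[OF that] by blast
  then have "card (\<Union>i<k. parcs (C i)) = (\<Sum>i<k. card (parcs (C i)))"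
    by (intro card_UN_disjoint) (use C3 in auto)
  also have "\<dots> = 6 * k" using C3 by simp
  finally have a: "card (\<Union>i<k. parcs (C i)) = 6 * k" .
  have "inj_on (\<lambda>i. (s i, t i)) {..<k}"
    using st D by (intro inj_onI) (metis Pair_inject disjoint_iff lessThan_iff)
  then have c: "card ((\<lambda>i. (s i, t i)) ` {..<k}) = k" by (simp add: card_image)
  \<comment> \<open>A connecting arc inside one copy would give \<open>(i + 1) mod k = i\<close>,
    impossible for \<open>k \<ge> 2\<close>.\<close>
  have "(\<Union>i<k. parcs (C i)) \<inter> (\<lambda>i. (s i, t i)) ` {..<k} = {}"
  proof (rule ccontr)
    assume "\<not> ?thesis"
    then obtain i j where ij: "i < k" "j < k" "(s i, t i) \<in> parcs (C j)" by auto
    then have mem: "s i \<in> pverts (C j)" "t i \<in> pverts (C j)" using C3(5)[of j] by auto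
    have "j = i" using mem st[OF ij(1)] D ij by blast
    moreover have "(i + 1) mod k < k" using k by simp
    then have "j = (i + 1) mod k" using mem st[OF ij(1)] D ij by blast
    ultimately have "(i + 1) mod k = i" by simp
    then show False using ij k by (cases "i + 1 = k") auto
  qed
  then have "card (parcs H) = 6 * k + k"
    using card_Un_disjoint[of "\<Union>i<k. parcs (C i)" "(\<lambda>i. (s i, t i)) ` {..<k}"] C3 a c
    by (simp add: H)
  with v show ?thesis by simp
qed

section \<open>Recognizing members of the family up to isomorphism\<close>

lemma card_digraph_iso:
  assumes "digraph_iso G H"
  shows "card (verts H) = card (verts G)" "card (arcs H) = card (arcs G)"
  using assms by (auto simp: digraph_iso_def pre_digraph.digraph_isomorphism_def card_image)

text \<open>The relabelled digraph is \<open>app_iso f D\<close>, where \<open>f\<close> sends an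
  arc to the pair of its relabelled ends; this is injective for lack of parallel arcs. The
  isomorphism is then reversed.\<close>

lemma digraph_iso_relabel:
  assumes "digraph D" "inj_on \<phi> (verts D)"
  shows "digraph_iso (with_proj \<lparr>pverts = \<phi> ` verts D,
    parcs = (\<lambda>(u, v). (\<phi> u, \<phi> v)) ` arcs_ends D\<rparr>) D"
proof (rule digraph_iso_swap)
  interpret digraph D by fact
  show "wf_digraph D" by (rule wf_digraph)
  define f where "f = \<lparr>iso_verts = \<phi>, iso_arcs = (\<lambda>e. (\<phi> (tail D e), \<phi> (head D e))),
    iso_head = snd, iso_tail = fst\<rparr>"
  have "inj_on (\<lambda>e. (\<phi> (tail D e), \<phi> (head D e))) (arcs D)"
  proof (rule inj_onI)
    fix e e' assume e: "e \<in> arcs D" "e' \<in> arcs D"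
      "(\<phi> (tail D e), \<phi> (head D e)) = (\<phi> (tail D e'), \<phi> (head D e'))"
    then have "arc_to_ends D e = arc_to_ends D e'"
      using assms(2) by (auto simp: arc_to_ends_def dest: inj_onD)
    then show "e = e'" using e no_multi_arcs by blast
  qed
  then have "digraph_isomorphism f"
    using assms(2) by (auto simp: digraph_isomorphism_def f_def wf_digraph)
  moreover have "with_proj \<lparr>pverts = \<phi> ` verts D,
    parcs = (\<lambda>(u, v). (\<phi> u, \<phi> v)) ` arcs_ends D\<rparr> = app_iso f D"
    by (simp add: with_proj_def app_iso_def f_def arcs_ends_conv image_image)
  ultimately show "digraph_iso D (with_proj \<lparr>pverts = \<phi> ` verts D,
    parcs = (\<lambda>(u, v). (\<phi> u, \<phi> v)) ` arcs_ends D\<rparr>)"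
    unfolding digraph_iso_def by blast
qed

text \<open>A finite vertex set embeds into the natural numbers. Carried over by this injection, the
  sets \<open>X i\<close> become the complete copies and the pairs \<open>(s i, t i)\<close> the
  connecting arcs.\<close>

lemma in_family_D_of_block_structure:
  fixes k :: nat
  assumes "digraph D" and k: "k \<ge> 2" and V: "verts D = (\<Union>i<k. X i)"
    and disj: "disjoint_family_on X {..<k}"
    and X: "\<And>i. i < k \<Longrightarrow> card (X i) = 3 \<and> s i \<in> X i \<and> t i \<in> X ((i + 1) mod k)"
    and N: "\<And>i x. i < k \<Longrightarrow> x \<in> X i \<Longrightarrow>
      out_neighborhood D x = X i - {x} \<union> (if x = s i then {t i} else {})"
  shows "in_family_D D"
proof -
  interpret digraph D by fact
  obtain \<phi> :: "'a \<Rightarrow> nat" where \<phi>: "inj_on \<phi> (verts D)"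
    using finite_imp_inj_to_nat_seg[OF finite_verts] by blast
  define C where "C i = \<lparr>pverts = \<phi> ` X i,
    parcs = {(a, b). (a, b) \<in> \<phi> ` X i \<times> \<phi> ` X i \<and> a \<noteq> b}\<rparr>" for i
  have XV: "X i \<subseteq> verts D" if "i < k" for i using V that by auto
  have inj: "inj_on \<phi> (X i)" if "i < k" for i using \<phi> XV[OF that] by (rule inj_on_subset)
  have "arcs_ends D = (\<Union>i<k. {(u, v). (u, v) \<in> X i \<times> X i \<and> u \<noteq> v}) \<union> (\<lambda>i. (s i, t i)) ` {..<k}"
    (is "_ = ?R")
  proof -
    have "arcs_ends D = (SIGMA u:verts D. out_neighborhood D u)"
      by (rule arcs_ends_eq_Sigma) (rule wf_digraph)
    also have "\<dots> = (\<Union>i<k. SIGMA x:X i. out_neighborhood D x)"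
      unfolding V by auto
    also have "\<dots> = (\<Union>i<k. {(u, v). (u, v) \<in> X i \<times> X i \<and> u \<noteq> v} \<union> {(s i, t i)})"
    proof (rule SUP_cong)
      fix i assume "i \<in> {..<k}"
      then have i: "i < k" by simp
      have "(SIGMA x:X i. out_neighborhood D x) =
          (SIGMA x:X i. X i - {x} \<union> (if x = s i then {t i} else {}))"
        by (rule Sigma_cong) (simp_all add: N[OF i])
      \<comment> \<open>Since \<open>s i\<close> belongs to \<open>X i\<close>, the conditional
        contributes exactly one extra pair.\<close>
      also have "\<dots> = {(u, v). (u, v) \<in> X i \<times> X i \<and> u \<noteq> v} \<union> {(s i, t i)}"
        using X[OF i] by (auto split: if_splits)
      finally show "(SIGMA x:X i. out_neighborhood D x) =
          {(u, v). (u, v) \<in> X i \<times> X i \<and> u \<noteq> v} \<union> {(s i, t i)}" .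
    qed simp
    also have "\<dots> = ?R" by auto
    finally show ?thesis .
  qed
  moreover have "(\<lambda>(u, v). (\<phi> u, \<phi> v)) ` {(u, v). (u, v) \<in> X i \<times> X i \<and> u \<noteq> v} = parcs (C i)"
    if "i < k" for i
    using inj[OF that] by (auto simp: C_def image_iff inj_on_eq_iff)
  ultimately have arcs: "(\<lambda>(u, v). (\<phi> u, \<phi> v)) ` arcs_ends D =
      (\<Union>i<k. parcs (C i)) \<union> (\<lambda>i. (\<phi> (s i), \<phi> (t i))) ` {..<k}"
    by (simp add: image_Un image_UN image_image)
  have verts: "\<phi> ` verts D = (\<Union>i<k. pverts (C i))" by (auto simp: V C_def)
  have "\<lparr>pverts = \<phi> ` verts D, parcs = (\<lambda>(u, v). (\<phi> u, \<phi> v)) ` arcs_ends D\<rparr> \<in> family_D"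
    unfolding family_D_def arcs verts
  proof (intro CollectI exI conjI allI impI)
    show "k \<ge> 2" by fact
  next
    fix i assume i: "i < k"
    then have "finite (X i)" using XV finite_verts finite_subset by blast
    then show "complete_digraph 3 (with_proj (C i))"
      using X[OF i] card_image[OF inj[OF i]] by (simp add: complete_digraph_pair_def C_def)
  next
    show "disjoint_family_on (\<lambda>i. pverts (C i)) {..<k}"
      unfolding disjoint_family_on_def
    proof (intro ballI impI)
      fix i j assume ij: "i \<in> {..<k}" "j \<in> {..<k}" "i \<noteq> j"
      then have "X i \<inter> X j = {}" using disj by (auto simp: disjoint_family_on_def)
      then have "\<phi> ` X i \<inter> \<phi> ` X j = {}"
        using inj_on_image_Int[OF \<phi> XV XV, of i j] ij by simp
      then show "pverts (C i) \<inter> pverts (C j) = {}" by (simp add: C_def)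
    qed
  next
    fix i assume i: "i < k"
    show "\<phi> (s i) \<in> pverts (C i)" "\<phi> (t i) \<in> pverts (C ((i + 1) mod k))"
      using X[OF i] by (auto simp: C_def)
  qed simp
  then show ?thesis
    unfolding in_family_D_def using digraph_iso_relabel[OF assms(1) \<phi>] by blast
qed

theorem theorem2:
  fixes D :: "('a, 'b) pre_digraph"
  assumes "digraph D"
    and "strongly_connected D"
    and "neighborhood_cyclic D"
    and "card (verts D) \<ge> 5"
  shows "real (card (arcs D)) \<ge> 7 / 3 * real (card (verts D)) \<and>
    (real (card (arcs D)) = 7 / 3 * real (card (verts D)) \<longleftrightarrow> in_family_D D)"
proof -
  interpret neighborhood_cyclic_relation "verts D" "out_neighborhood D"
    using assms by (rule neighborhood_cyclic_relation_digraph)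
  note m = card_arcs_eq_sum[OF assms(1)]
  have "in_family_D D" if "3 * card (arcs D) = 7 * card (verts D)"
  proof -
    interpret extremal_relation "verts D" "out_neighborhood D"
      by unfold_locales (use that m in simp)
    show ?thesis
      by (rule cyclic_block_structure) (rule in_family_D_of_block_structure[OF assms(1)])
  qed
  moreover have "3 * card (arcs D) = 7 * card (verts D)" if fam: "in_family_D D"
  proof -
    obtain H where "H \<in> family_D" "digraph_iso (with_proj H) D"
      using fam unfolding in_family_D_def by blast
    then show ?thesis using card_family_D[of H] card_digraph_iso[of "with_proj H" D] by simp
  qed
  moreover have "7 * card (verts D) \<le> 3 * card (arcs D)" using degree_sum_ge m by simp
  \<comment> \<open>Clearing the denominator reduces the real equation to the one between natural
    numbers.\<close>
  moreover have "real (card (arcs D)) = 7 / 3 * real (card (verts D)) \<longleftrightarrow>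
      3 * card (arcs D) = 7 * card (verts D)" (is "?L \<longleftrightarrow> ?R")
  proof
    show "?L \<Longrightarrow> ?R" by linarith
    show "?R \<Longrightarrow> ?L" by linarith
  qed
  moreover have "7 / 3 * real (card (verts D)) \<le> real (card (arcs D))"
    using \<open>7 * card (verts D) \<le> 3 * card (arcs D)\<close> by linarith
  ultimately show ?thesis by blast
qed

end
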